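(* Let $i_0,j_0$ be positive integers and let $t_{i,j}$ ($1\le i\le i_0$, $0\le j\le j_0$) be real numbers with $\hat t_i:=\sum_{j=0}^{j_0}t_{i,j}\ge0$ for all $i$, such that $T(x)=x^{i_0}-\sum_{i=1}^{i_0}\hat t_ix^{i_0-i}$ has the maximum root property with maximum root $\lambda_1$. Let $n_0$ be an integer and let $(p_{n,k})_{n,k\in\mathbb{Z}}$ be real numbers with $p_{n,k}=\sum_{i=1}^{i_0}\sum_{j=0}^{j_0}t_{i,j}p_{n-i,k-j}$ for all $n\ge n_0$ and all $k$, $p_{n,k}\ge0$ for all $n,k$, $p_{n,k}=0$ when $n<0$ or $k<0$, only finitely many $p_{n,k}$ with $n<n_0$ nonzero, and $\Omega_n:=\sum_{k\ge0}p_{n,k}=\Theta(\lambda_1^n)$. Then for all $n\ge n_0$ and all integers $m\ge0$, \[\tilde\mu_n(m)=\sum_{\ell=0}^m\binom{m}{\ell}\sum_{i=1}^{i_0}\sum_{j=0}^{j_0}\frac{\Omega_{n-i}\,t_{i,j}}{\Omega_n}\,(j+\mu_{n-i}-\mu_n)^\ell\,\tilde\mu_{n-i}(m-\ell).\]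
   Context: For a real number $\lambda_1>0$, a polynomial $A(x)$ has the maximum root property with maximum root $\lambda_1$ if $\lambda_1$ is a root of $A$ of multiplicity one and all other (complex) roots of $A$ have absolute value strictly less than $\lambda_1$. When $\Omega_n>0$, $X_n$ denotes the random variable with $\Pr[X_n=k]=p_{n,k}/\Omega_n$, $\mu_n=\mathbb{E}[X_n]$, and $\tilde\mu_n(m)=\mathbb{E}[(X_n-\mu_n)^m]$ is its $m$-th central moment (with $\tilde\mu_n(0)=1$). Any term of the sum carrying the factor $\Omega_{n-i}=0$ is interpreted as $0$. *)

theory Defs
  imports "HOL-Probability.Probability" "HOL-Library.Landau_Symbols"
    "HOL-Computational_Algebra.Polynomial"
begin

definition maximum_root :: "complex poly \<Rightarrow> real \<Rightarrow> bool" where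
  "maximum_root A r \<longleftrightarrow>
     r > 0 \<and> order (complex_of_real r) A = 1 \<and>
     (\<forall>z. poly A z = 0 \<longrightarrow> z \<noteq> complex_of_real r \<longrightarrow> cmod z < r)"

definition t_hat :: "nat \<Rightarrow> (nat \<Rightarrow> nat \<Rightarrow> real) \<Rightarrow> nat \<Rightarrow> real" where
  "t_hat j0 t i = (\<Sum>j=0..j0. t i j)"

definition T_poly :: "nat \<Rightarrow> nat \<Rightarrow> (nat \<Rightarrow> nat \<Rightarrow> real) \<Rightarrow> real poly" where
  "T_poly i0 j0 t = monom 1 i0 - (\<Sum>i=1..i0. monom (t_hat j0 t i) (i0 - i))"

definition Omega :: "(int \<Rightarrow> int \<Rightarrow> real) \<Rightarrow> int \<Rightarrow> real" where
  "Omega p n = (\<Sum>\<^sub>\<infinity>k\<in>{0..}. p n k)"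

text \<open>
  The distribution of $X_n$. It is meaningful only if \<open>Omega p n > 0\<close> (and \<open>p n\<close> is nonnegative,
  summable and vanishes on negative arguments); otherwise \<open>embed_pmf\<close> is unspecified,
  so that \<open>mu p n\<close> and \<open>central_moment p n m\<close> are arbitrary reals.
\<close>
definition X_pmf :: "(int \<Rightarrow> int \<Rightarrow> real) \<Rightarrow> int \<Rightarrow> int pmf" where
  "X_pmf p n = embed_pmf (\<lambda>k. p n k / Omega p n)"

definition mu :: "(int \<Rightarrow> int \<Rightarrow> real) \<Rightarrow> int \<Rightarrow> real" where
  "mu p n = measure_pmf.expectation (X_pmf p n) real_of_int"

definition central_moment :: "(int \<Rightarrow> int \<Rightarrow> real) \<Rightarrow> int \<Rightarrow> nat \<Rightarrow> real" where
  "central_moment p n m =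
     measure_pmf.expectation (X_pmf p n) (\<lambda>k. (real_of_int k - mu p n) ^ m)"

end

theory Submission
  imports Defs
begin

text \<open>
  Each row \<open>p n\<close> has finite support, so \<open>\<Omega>\<^sub>n * E[f(X\<^sub>n)]\<close> is the finite sum of
  \<open>p n k * f k\<close>. Multiplying the recurrence by \<open>(k - \<mu>\<^sub>n)\<^sup>m\<close>, summing over \<open>k\<close> and shifting the
  index by \<open>j\<close> produces \<open>((j + \<mu>\<^sub>n\<^sub>-\<^sub>i - \<mu>\<^sub>n) + (k - \<mu>\<^sub>n\<^sub>-\<^sub>i))\<^sup>m\<close>, which the binomial theorem
  expands. Rows with \<open>\<Omega>\<^sub>n\<^sub>-\<^sub>i = 0\<close> vanish identically and contribute nothing to either side.
\<close>

text \<open>A nonzero entry of row \<open>n\<close> forces a nonzero summand in the recurrence, so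
  its column is a shift by some \<open>j\<close> of a support point of one of the \<open>i0\<close>
  preceding rows. Finitely many finite sets are thus enough, and strong induction on the row
  finishes.\<close>

lemma finite_support_of_recurrence:
  fixes p :: "int \<Rightarrow> int \<Rightarrow> real" and t :: "nat \<Rightarrow> nat \<Rightarrow> real" and n0 n :: int
  assumes rec: "\<And>n k. n \<ge> n0 \<Longrightarrow>
      p n k = (\<Sum>i=1..i0. \<Sum>j=0..j0. t i j * p (n - int i) (k - int j))"
    and init: "\<And>n. n < n0 \<Longrightarrow> finite {k. p n k \<noteq> 0}"
  shows "finite {k. p n k \<noteq> 0}"
\<comment> \<open>The \<open>+ 1\<close> keeps the measure positive at \<open>n = n0\<close>, so
  stepping back by \<open>i \<ge> 1\<close> decreases it strictly even when the earlier row lies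
  below \<open>n0\<close>, where \<open>nat\<close> truncates to 0.\<close>
proof (induction "nat (n - n0 + 1)" arbitrary: n rule: less_induct)
  case less
  show ?case
  proof (cases "n < n0")
    case False
    let ?B = "\<Union>i\<in>{1..i0}. \<Union>j\<in>{0..j0}. (\<lambda>k. k + int j) ` {k. p (n - int i) k \<noteq> 0}"
    have "finite {k. p (n - int i) k \<noteq> 0}" if "i \<in> {1..i0}" for i
      by (rule less) (use that False in auto)
    then have "finite ?B" by auto
    moreover have "{k. p n k \<noteq> 0} \<subseteq> ?B"
    proof
      fix k assume "k \<in> {k. p n k \<noteq> 0}"
      then have "(\<Sum>i=1..i0. \<Sum>j=0..j0. t i j * p (n - int i) (k - int j)) \<noteq> 0"
        using rec[of n k] False by simp
      then obtain i where i: "i \<in> {1..i0}"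
          "(\<Sum>j=0..j0. t i j * p (n - int i) (k - int j)) \<noteq> 0"
        by (rule sum.not_neutral_contains_not_neutral)
      then obtain j where j: "j \<in> {0..j0}" "t i j * p (n - int i) (k - int j) \<noteq> 0"
        by (elim sum.not_neutral_contains_not_neutral)
      have "k = (k - int j) + int j" "k - int j \<in> {k. p (n - int i) k \<noteq> 0}"
        using j by auto
      then show "k \<in> ?B" using i(1) j(1) by blast
    qed
    ultimately show ?thesis by (rule finite_subset[rotated])
  qed (use init in simp)
qed

lemma Omega_eq_sum:
  assumes "finite {k. p n k \<noteq> 0}" and "\<And>k. k < 0 \<Longrightarrow> p n k = 0"
  shows "Omega p n = (\<Sum>k | p n k \<noteq> 0. p n k)"
proof -
  have "Omega p n = infsum (p n) {k. p n k \<noteq> 0}"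
    unfolding Omega_def by (rule infsum_cong_neutral) (use assms(2) in force)+
  then show ?thesis using assms(1) by simp
qed

text \<open>\<open>embed_pmf\<close> has the intended mass function once the weights are known to be
  nonnegative with total mass 1. Finite support reduces this check, and then the expectation, to
  finite sums.\<close>

lemma expectation_X_pmf:
  fixes f :: "int \<Rightarrow> real"
  assumes fin: "finite {k. p n k \<noteq> 0}" and neg: "\<And>k. k < 0 \<Longrightarrow> p n k = 0"
    and nonneg: "\<And>k. p n k \<ge> 0" and pos: "Omega p n > 0"
  shows "measure_pmf.expectation (X_pmf p n) f = (\<Sum>k | p n k \<noteq> 0. p n k * f k) / Omega p n"
proof -
  let ?S = "{k. p n k \<noteq> 0}"
  have "(\<integral>\<^sup>+ k. ennreal (p n k / Omega p n) \<partial>count_space UNIV)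
      = (\<Sum>k\<in>?S. ennreal (p n k / Omega p n))"
    by (rule nn_integral_count_space'[OF fin]) auto
  also have "\<dots> = ennreal (\<Sum>k\<in>?S. p n k / Omega p n)"
    using nonneg pos by (intro sum_ennreal) simp
  also have "(\<Sum>k\<in>?S. p n k / Omega p n) = 1"
    using pos Omega_eq_sum[of p n, OF fin neg] by (simp flip: sum_divide_distrib)
  finally have pmf: "pmf (X_pmf p n) k = p n k / Omega p n" for k
    unfolding X_pmf_def using nonneg pos by (intro pmf_embed_pmf) auto
  have "set_pmf (X_pmf p n) \<subseteq> ?S" by (auto simp: set_pmf_eq pmf)
  then have "measure_pmf.expectation (X_pmf p n) f = (\<Sum>k\<in>?S. f k * pmf (X_pmf p n) k)"
    by (intro integral_measure_pmf_real[OF fin]) auto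
  then show ?thesis by (simp add: pmf sum_divide_distrib mult.commute)
qed

text \<open>This product form avoids assuming \<open>Omega p n > 0\<close>, which may fail for the
  earlier rows in the recurrence: the factor 0 then cancels the unspecified value of
  \<open>central_moment\<close>.\<close>

lemma Omega_mult_central_moment:
  assumes fin: "finite {k. p n k \<noteq> 0}" and neg: "\<And>k. k < 0 \<Longrightarrow> p n k = 0"
    and nonneg: "\<And>k. p n k \<ge> 0"
  shows "Omega p n * central_moment p n m
      = (\<Sum>k | p n k \<noteq> 0. p n k * (real_of_int k - mu p n) ^ m)"
proof (cases "Omega p n = 0")
  case True
  then have "(\<Sum>k | p n k \<noteq> 0. p n k) = 0"
    using Omega_eq_sum[of p n, OF fin neg] by simp
  \<comment> \<open>Nonnegative entries with sum 0 all vanish, so the right-hand side is an empty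
    sum.\<close>
  then have "{k. p n k \<noteq> 0} = {}"
    using sum_nonneg_eq_0_iff[OF fin, of "p n"] nonneg by auto
  then show ?thesis using True by simp
next
  case False
  then have pos: "Omega p n > 0"
    using Omega_eq_sum[of p n, OF fin neg] sum_nonneg[of "{k. p n k \<noteq> 0}" "p n"] nonneg by simp
  then show ?thesis
    unfolding central_moment_def by (simp add: expectation_X_pmf[of p n, OF fin neg nonneg pos])
qed

text \<open>The recurrence is tested against an arbitrary \<open>f\<close>; substituting
  \<open>k + int j\<close> for \<open>k\<close> moves the shift from \<open>p\<close> to
  \<open>f\<close>.\<close>

lemma sum_support_recurrence:
  fixes p :: "int \<Rightarrow> int \<Rightarrow> real" and t :: "nat \<Rightarrow> nat \<Rightarrow> real" and f :: "int \<Rightarrow> real"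
  assumes rec: "\<And>k. p n k = (\<Sum>i\<in>I. \<Sum>j\<in>J. t i j * p (n - int i) (k - int j))"
    and fin: "\<And>n. finite {k. p n k \<noteq> 0}" and "finite I" "finite J"
  shows "(\<Sum>k | p n k \<noteq> 0. p n k * f k) =
    (\<Sum>i\<in>I. \<Sum>j\<in>J. t i j * (\<Sum>k | p (n - int i) k \<noteq> 0. p (n - int i) k * f (k + int j)))"
proof -
  define shifted where "shifted i j = (\<lambda>k. k + int j) ` {k. p (n - int i) k \<noteq> 0}" for i j :: nat
  \<comment> \<open>The rows have different supports, so every sum is taken over one finite set on
    which the order of summation can be exchanged; the extra terms are zero.\<close>
  define K where "K = {k. p n k \<noteq> 0} \<union> (\<Union>i\<in>I. \<Union>j\<in>J. shifted i j)"
  have finK: "finite K" unfolding K_def shifted_def using fin assms(3,4) by auto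
  have shift: "(\<Sum>k\<in>K. p (n - int i) (k - int j) * f k)
      = (\<Sum>k | p (n - int i) k \<noteq> 0. p (n - int i) k * f (k + int j))" if "i \<in> I" "j \<in> J" for i j
  proof -
    have out: "p (n - int i) (k - int j) = 0" if "k \<notin> shifted i j" for k
    proof (rule ccontr)
      assume "p (n - int i) (k - int j) \<noteq> 0"
      then have "(k - int j) + int j \<in> shifted i j" unfolding shifted_def by blast
      then show False using that by simp
    qed
    have "(\<Sum>k\<in>K. p (n - int i) (k - int j) * f k)
        = (\<Sum>k\<in>shifted i j. p (n - int i) (k - int j) * f k)"
      by (rule sum.mono_neutral_right[OF finK]) (use that out in \<open>auto simp: K_def\<close>)
    also have "\<dots> = (\<Sum>k | p (n - int i) k \<noteq> 0. p (n - int i) k * f (k + int j))"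
      unfolding shifted_def by (subst sum.reindex) (auto simp: inj_on_def)
    finally show ?thesis .
  qed
  have "(\<Sum>k | p n k \<noteq> 0. p n k * f k) = (\<Sum>k\<in>K. p n k * f k)"
    by (rule sum.mono_neutral_left[OF finK]) (auto simp: K_def)
  also have "\<dots> = (\<Sum>k\<in>K. \<Sum>i\<in>I. \<Sum>j\<in>J. t i j * (p (n - int i) (k - int j) * f k))"
    by (subst rec) (simp add: sum_distrib_right mult.assoc)
  also have "\<dots> = (\<Sum>i\<in>I. \<Sum>j\<in>J. t i j * (\<Sum>k\<in>K. p (n - int i) (k - int j) * f k))"
    by (subst sum.swap, rule sum.cong[OF refl], subst sum.swap) (simp add: sum_distrib_left)
  finally show ?thesis using shift by simp
qed

theorem theorem2p10:
  fixes i0 j0 :: nat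
    and t :: "nat \<Rightarrow> nat \<Rightarrow> real"
    and lambda1 :: real
    and n0 :: int
    and p :: "int \<Rightarrow> int \<Rightarrow> real"
  assumes "i0 > 0" and "j0 > 0"
    and "\<forall>i\<in>{1..i0}. t_hat j0 t i \<ge> 0"
    and "maximum_root (map_poly complex_of_real (T_poly i0 j0 t)) lambda1"
    and "\<forall>n\<ge>n0. \<forall>k. p n k = (\<Sum>i=1..i0. \<Sum>j=0..j0. t i j * p (n - int i) (k - int j))"
    and "\<forall>n k. p n k \<ge> 0"
    and "\<forall>n k. n < 0 \<or> k < 0 \<longrightarrow> p n k = 0"
    and "finite {(n, k). n < n0 \<and> p n k \<noteq> 0}"
    and "(\<lambda>n::nat. Omega p (int n)) \<in> \<Theta>(\<lambda>n. lambda1 ^ n)"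
  shows "\<forall>n\<ge>n0. Omega p n > 0 \<longrightarrow> (\<forall>m::nat.
    central_moment p n m =
      (\<Sum>l=0..m. real (m choose l) *
        (\<Sum>i=1..i0. \<Sum>j=0..j0.
          Omega p (n - int i) * t i j / Omega p n *
          (real j + mu p (n - int i) - mu p n) ^ l *
          central_moment p (n - int i) (m - l))))"
proof (intro allI impI)
  fix n :: int and m :: nat
  assume n: "n \<ge> n0" and pos: "Omega p n > 0"
  have rec: "p n k = (\<Sum>i=1..i0. \<Sum>j=0..j0. t i j * p (n - int i) (k - int j))"
    if "n \<ge> n0" for n k
    using assms(5) that by blast
  have nonneg: "p n k \<ge> 0" for n k using assms(6) by blast
  have neg: "p n k = 0" if "k < 0" for n k using assms(7) that by blast
  have "finite {k. p n' k \<noteq> 0}" if "n' < n0" for n'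
  proof (rule finite_subset)
    show "{k. p n' k \<noteq> 0} \<subseteq> snd ` {(n, k). n < n0 \<and> p n k \<noteq> 0}" using that by force
  qed (use assms(8) in simp)
  then have fin: "finite {k. p n' k \<noteq> 0}" for n'
    using rec by (rule finite_support_of_recurrence[rotated])
  have moment: "Omega p n * central_moment p n m
      = (\<Sum>k | p n k \<noteq> 0. p n k * (real_of_int k - mu p n) ^ m)" for n m
    by (rule Omega_mult_central_moment) (fact fin neg nonneg)+
  \<comment> \<open>\<open>d i j\<close> collects the part of the recentred deviation that does not
    depend on \<open>k\<close>, so its powers come out of the sum over \<open>k\<close> after the
    binomial expansion.\<close>
  define d where "d i j = real j + mu p (n - int i) - mu p n" for i j
  have expand: "(\<Sum>k | p n' k \<noteq> 0. p n' k * (real_of_int (k + int j) - mu p n) ^ m)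
      = (\<Sum>l=0..m. real (m choose l) * d i j ^ l * (Omega p n' * central_moment p n' (m - l)))"
    if n': "n' = n - int i" for n' i j
  proof -
    have "real_of_int (k + int j) - mu p n = d i j + (real_of_int k - mu p n')" for k
      by (simp add: d_def n')
    then have "(\<Sum>k | p n' k \<noteq> 0. p n' k * (real_of_int (k + int j) - mu p n) ^ m)
      = (\<Sum>k | p n' k \<noteq> 0. \<Sum>l=0..m. real (m choose l) * d i j ^ l *
          (p n' k * (real_of_int k - mu p n') ^ (m - l)))"
      by (simp only: binomial_ring sum_distrib_left atLeast0AtMost mult_ac)
    also have "\<dots> = (\<Sum>l=0..m. real (m choose l) * d i j ^ l *
          (\<Sum>k | p n' k \<noteq> 0. p n' k * (real_of_int k - mu p n') ^ (m - l)))"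
      by (subst sum.swap) (simp add: sum_distrib_left)
    finally show ?thesis by (simp add: moment)
  qed
  have "Omega p n * central_moment p n m = (\<Sum>i=1..i0. \<Sum>j=0..j0. t i j *
      (\<Sum>l=0..m. real (m choose l) * d i j ^ l *
        (Omega p (n - int i) * central_moment p (n - int i) (m - l))))"
    by (subst moment, subst sum_support_recurrence[OF rec[OF n] fin])
      (simp_all only: expand finite_atLeastAtMost)
  \<comment> \<open>The binomial index \<open>l\<close> is innermost here but outermost in the
    claim; it is moved past \<open>j\<close> first and past \<open>i\<close> next.\<close>
  also have "\<dots> = (\<Sum>i=1..i0. \<Sum>l=0..m. \<Sum>j=0..j0. real (m choose l) *
      (Omega p (n - int i) * t i j * d i j ^ l * central_moment p (n - int i) (m - l)))"
    by (subst (2) sum.swap) (simp add: sum_distrib_left mult_ac)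
  also have "\<dots> = (\<Sum>l=0..m. real (m choose l) * (\<Sum>i=1..i0. \<Sum>j=0..j0.
      Omega p (n - int i) * t i j * d i j ^ l * central_moment p (n - int i) (m - l)))"
    by (subst sum.swap) (simp add: sum_distrib_left)
  \<comment> \<open>Positivity is needed only for row \<open>n\<close>, to divide by
    \<open>Omega p n\<close>.\<close>
  finally have "central_moment p n m = (\<Sum>l=0..m. real (m choose l) * (\<Sum>i=1..i0. \<Sum>j=0..j0.
      Omega p (n - int i) * t i j * d i j ^ l * central_moment p (n - int i) (m - l))) / Omega p n"
    using pos by (simp add: field_simps)
  then show "central_moment p n m =
      (\<Sum>l=0..m. real (m choose l) *
        (\<Sum>i=1..i0. \<Sum>j=0..j0.
          Omega p (n - int i) * t i j / Omega p n *
          (real j + mu p (n - int i) - mu p n) ^ l *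
          central_moment p (n - int i) (m - l)))"
    by (simp add: d_def sum_divide_distrib sum_distrib_left mult.assoc)
qed

end
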